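(* Let $D_L\subset\mathbb{R}^n$ be a compact and star-shaped set and let ${\bf x}^\ast$ be an equilibrium of $\frac{d}{dt}{\bf x}=f({\bf x})$. Assume that $$f({\bf x})^T Y ({\bf x}-{\bf x}^\ast) + ({\bf x}-{\bf x}^\ast)^T Y f({\bf x})$$ is strictly negative for all ${\bf x}\in D_L$, where $Y$ is the real symmetric matrix described in the context. Then $L({\bf x}) = ({\bf x}-{\bf x}^\ast)^T Y ({\bf x}-{\bf x}^\ast)$ is a Lyapunov function on $D_L$.
   Context: $f:\mathbb{R}^n\to\mathbb{R}^n$ is a smooth map and $\varphi$ is the flow generated by $\frac{d}{dt}{\bf x}=f({\bf x})$. A point ${\bf x}^\ast$ is an equilibrium if $f({\bf x}^\ast)={\bf 0}$; the set $D_L$ is not required to contain ${\bf x}^\ast$. A set is star-shaped if it contains a point such that the segment from this point to any point of the set lies in the set. The matrix $Y$ is $Y=\mathrm{Re}(X^{-H}I^\ast X^{-1})$, where $X$ is a nonsingular complex $n\times n$ matrix, $X^{-H}$ is the inverse of its Hermitian transpose, and $I^\ast=\mathrm{diag}(i_1,\dots,i_n)$ with $i_k=1$ if $\mathrm{Re}(\lambda_k)<0$ and $i_k=-1$ if $\mathrm{Re}(\lambda_k)>0$, for complex numbers $\lambda_1,\dots,\lambda_n$ with nonzero real parts. (In practice $X$ and $\lambda_k$ are numerically computed approximate eigenvectors and eigenvalues of $Df({\bf x}^\ast)$; no exactness is assumed.) $Y$ is real and symmetric. A $C^1$ function $L$ is a Lyapunov function on a set $D$ if (1) $\frac{d}{dt}L(\varphi(t,{\bf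 x}))|_{t=0}\le 0$ for every ${\bf x}\in D$; and (2) for ${\bf x}\in D$, $\frac{d}{dt}L(\varphi(t,{\bf x}))|_{t=0}=0$ implies that $\varphi(t,{\bf x})\equiv\bar{\bf x}\in D$ for an equilibrium $\bar{\bf x}$. *)

theory Defs
  imports "HOL-Analysis.Analysis"
begin

(* In finite dimension, f is C^(k+1) iff it is differentiable and each of its
   directional derivatives is C^k. *)
fun k_times_cont_diff ::
  "nat \<Rightarrow> ('a::euclidean_space \<Rightarrow> 'b::real_normed_vector) \<Rightarrow> bool" where
  "k_times_cont_diff 0 f \<longleftrightarrow> continuous_on UNIV f"
| "k_times_cont_diff (Suc k) f \<longleftrightarrow>
     (\<forall>x. f differentiable (at x)) \<and>
     (\<forall>v. k_times_cont_diff k (\<lambda>x. frechet_derivative f (at x) v))"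

definition smooth_map :: "('a::euclidean_space \<Rightarrow> 'b::real_normed_vector) \<Rightarrow> bool" where
  "smooth_map f \<longleftrightarrow> (\<forall>k. k_times_cont_diff k f)"

definition equilibrium :: "('a::euclidean_space \<Rightarrow> 'a) \<Rightarrow> 'a \<Rightarrow> bool" where
  "equilibrium f x \<longleftrightarrow> f x = 0"

definition solves_ivp ::
  "('a::euclidean_space \<Rightarrow> 'a) \<Rightarrow> 'a \<Rightarrow> real set \<Rightarrow> (real \<Rightarrow> 'a) \<Rightarrow> bool" where
  "solves_ivp f x I u \<longleftrightarrow>
     open I \<and> is_interval I \<and> 0 \<in> I \<and> u 0 = x \<and>
     (\<forall>t\<in>I. (u has_vector_derivative f (u t)) (at t))"

(* The flow need not be complete: J x is the maximal interval of existence of the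
   trajectory through x, and phi t x carries no information for t outside J x.
   For a locally Lipschitz f, J and the values of phi on J are determined by f. *)
definition is_flow ::
  "('a::euclidean_space \<Rightarrow> 'a) \<Rightarrow> ('a \<Rightarrow> real set) \<Rightarrow> (real \<Rightarrow> 'a \<Rightarrow> 'a) \<Rightarrow> bool" where
  "is_flow f J \<phi> \<longleftrightarrow>
     (\<forall>x. solves_ivp f x (J x) (\<lambda>t. \<phi> t x) \<and>
          (\<forall>I u. solves_ivp f x I u \<longrightarrow> I \<subseteq> J x \<and> (\<forall>t\<in>I. u t = \<phi> t x)))"

(* The derivatives at 0 exist because L is C^1 and trajectories are differentiable. *)
definition lyapunov_function ::
  "('a::euclidean_space \<Rightarrow> 'a) \<Rightarrow> ('a \<Rightarrow> real set) \<Rightarrow> (real \<Rightarrow> 'a \<Rightarrow> 'a) \<Rightarrow>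
   'a set \<Rightarrow> ('a \<Rightarrow> real) \<Rightarrow> bool" where
  "lyapunov_function f J \<phi> D L \<longleftrightarrow>
     k_times_cont_diff 1 L \<and>
     (\<forall>x\<in>D. deriv (\<lambda>t. L (\<phi> t x)) 0 \<le> 0) \<and>
     (\<forall>x\<in>D. deriv (\<lambda>t. L (\<phi> t x)) 0 = 0 \<longrightarrow>
        (\<exists>xbar\<in>D. equilibrium f xbar \<and> (\<forall>t\<in>J x. \<phi> t x = xbar)))"

definition hermitian_transpose :: "complex^'n^'m \<Rightarrow> complex^'m^'n" where
  "hermitian_transpose A = (\<chi> i j. cnj (A $ j $ i))"

definition sign_matrix :: "complex^'n \<Rightarrow> complex^'n^'n" where
  "sign_matrix lam =
     (\<chi> i j. if i = j then (if Re (lam $ i) < 0 then 1 else - 1) else 0)"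

definition lyapunov_matrix :: "complex^'n^'n \<Rightarrow> complex^'n \<Rightarrow> real^'n^'n" where
  "lyapunov_matrix X lam =
     (\<chi> i j. Re ((matrix_inv (hermitian_transpose X) ** sign_matrix lam ** matrix_inv X) $ i $ j))"

end

theory Submission
  imports Defs
begin

text \<open>By the chain rule, the derivative of \<open>L\<close> along the trajectory through
  \<open>x\<close> at time 0 is the derivative of \<open>L\<close> at \<open>x\<close> applied to
  the velocity \<open>f x\<close> (\<open>deriv_along_flow\<close>). For the quadratic form this is
  exactly the expression assumed negative on \<open>D\<^sub>L\<close>
  (\<open>has_derivative_shifted_quadratic_form\<close>). So \<open>L\<close> strictly decreases at
  every point of \<open>D\<^sub>L\<close>, and the case of a vanishing derivative never
  arises.\<close>

text \<open>Product rule for a bilinear form. The two terms are kept apart so that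
  \<open>v = f x\<close> yields the assumed expression literally.\<close>

lemma has_derivative_shifted_quadratic_form:
  fixes A :: "real^'n^'n"
  shows "((\<lambda>x. (x - c) \<bullet> (A *v (x - c))) has_derivative
          (\<lambda>v. v \<bullet> (A *v (x - c)) + (x - c) \<bullet> (A *v v))) (at x within S)"
proof -
  have "((\<lambda>x. x - c) has_derivative (\<lambda>v. v)) (at x within S)"
    by (auto intro!: derivative_eq_intros)
  then show ?thesis
    by (auto intro!: derivative_eq_intros
        bounded_linear.has_derivative[OF matrix_vector_mul_bounded_linear])
qed

text \<open>For a fixed direction \<open>v\<close> the directional derivative is affine in
  \<open>x\<close>, hence continuous.\<close>

lemma k_times_cont_diff_1_shifted_quadratic_form:
  fixes A :: "real^'n^'n"
  shows "k_times_cont_diff 1 (\<lambda>x. (x - c) \<bullet> (A *v (x - c)))"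
proof -
  let ?L = "\<lambda>x. (x - c) \<bullet> (A *v (x - c))"
  have "frechet_derivative ?L (at x) = (\<lambda>v. v \<bullet> (A *v (x - c)) + (x - c) \<bullet> (A *v v))" for x
    using has_derivative_shifted_quadratic_form by (rule frechet_derivative_at[symmetric])
  moreover have "?L differentiable (at x)" for x
    using has_derivative_shifted_quadratic_form by (rule differentiableI)
  ultimately show ?thesis
    by (auto intro!: continuous_intros
        bounded_linear.continuous_on[OF matrix_vector_mul_bounded_linear])
qed

lemma deriv_along_flow:
  assumes "is_flow f J \<phi>" "(L has_derivative L') (at x)"
  shows "deriv (\<lambda>t. L (\<phi> t x)) 0 = L' (f x)"
proof -
  from assms(1) have "\<phi> 0 x = x" and "((\<lambda>t. \<phi> t x) has_vector_derivative f (\<phi> 0 x)) (at 0)"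
    unfolding is_flow_def solves_ivp_def by blast+
  \<comment> \<open>The chain rule asks for the derivative of \<open>L\<close> only within the range
    of the trajectory, at \<open>\<phi> 0 x = x\<close>; the full derivative at \<open>x\<close>
    restricts to it.\<close>
  with assms(2) have "((\<lambda>t. L (\<phi> t x)) has_vector_derivative L' (f x)) (at 0)"
    using vector_derivative_diff_chain_within[of "\<lambda>t. \<phi> t x" "f x" 0 UNIV L L']
    by (auto simp: o_def intro: has_derivative_at_withinI)
  then show ?thesis
    by (simp add: DERIV_imp_deriv has_real_derivative_iff_has_vector_derivative)
qed

theorem corollary2:
  fixes f :: "real^'n \<Rightarrow> real^'n"
    and J :: "real^'n \<Rightarrow> real set"
    and \<phi> :: "real \<Rightarrow> real^'n \<Rightarrow> real^'n"
    and X :: "complex^'n^'n"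
    and lam :: "complex^'n"
    and Y :: "real^'n^'n"
    and D\<^sub>L :: "(real^'n) set"
    and xstar :: "real^'n"
  assumes "smooth_map f"
    and "is_flow f J \<phi>"
    and "invertible X"
    and "\<And>k. Re (lam $ k) \<noteq> 0"
    and "Y = lyapunov_matrix X lam"
    and "compact D\<^sub>L"
    and "starlike D\<^sub>L"
    and "equilibrium f xstar"
    and "\<And>x. x \<in> D\<^sub>L \<Longrightarrow>
           f x \<bullet> (Y *v (x - xstar)) + (x - xstar) \<bullet> (Y *v f x) < 0"
  shows "lyapunov_function f J \<phi> D\<^sub>L (\<lambda>x. (x - xstar) \<bullet> (Y *v (x - xstar)))"
proof -
  let ?L = "\<lambda>x. (x - xstar) \<bullet> (Y *v (x - xstar))"
  \<comment> \<open>Strictness settles both conditions on the derivative: it gives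
    \<open>\<le> 0\<close> and makes the premise \<open>= 0\<close> false.\<close>
  have "deriv (\<lambda>t. ?L (\<phi> t x)) 0 < 0" if "x \<in> D\<^sub>L" for x
    using assms(9)[OF that]
    by (simp add: deriv_along_flow[OF assms(2) has_derivative_shifted_quadratic_form])
  then show ?thesis
    unfolding lyapunov_function_def
    using k_times_cont_diff_1_shifted_quadratic_form[of xstar Y] by force
qed

end
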